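(* Let $k$ be a positive integer and let $n\ge 16\cdot 2^k-1$. Then the hypercube $Q_n$ contains $2^k$ pairwise completely independent spanning trees.
   Context: The hypercube $Q_n$ has vertex set $\{0,1\}^n$, two vertices being adjacent if they differ in exactly one coordinate. Two spanning trees of a graph $G$ are completely independent if they have no edge in common and, for every pair of vertices $u,v$ of $G$, the $u$–$v$ paths in the two trees have no vertex in common other than $u$ and $v$. *)

theory Defs
  imports "Graph_Theory.Graph_Theory"
begin

text \<open>
  Simple undirected graphs are the symmetric, loop-free, finite digraphs of the locale
  \<^locale>\<open>pair_graph\<close>: an undirected edge \<open>uv\<close> is the pair of arcs \<open>(u, v)\<close>, \<open>(v, u)\<close>.
\<close>

text \<open>Vertices are the 0-1 vectors of length \<open>n\<close>, as lists of bits.\<close>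

definition hypercube :: "nat \<Rightarrow> bool list pair_pre_digraph" where
  "hypercube n =
     \<lparr> pverts = {x. length x = n},
       parcs = {(x, y). length x = n \<and> length y = n \<and> card {i. i < n \<and> x ! i \<noteq> y ! i} = 1} \<rparr>"

text \<open>
  The library's \<^const>\<open>tree\<close> and \<^const>\<open>spanning_tree\<close> are not the undirected notions: for
  \<^const>\<open>forest\<close> the closed walk \<open>u, v, u\<close> along one undirected edge counts as a cycle, whereas
  an acyclic orientation of an undirected cycle has none. In a symmetric digraph, the cycles of
  the undirected graph are the library's cycles of length at least 3.
\<close>

definition undirected_tree :: "'a pair_pre_digraph \<Rightarrow> bool" where
  "undirected_tree T \<longleftrightarrow>
     pair_graph T \<and> connected (with_proj T) \<and>
     \<not> (\<exists>p. pre_digraph.cycle (with_proj T) p \<and> 3 \<le> length p)"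

definition undirected_spanning_tree :: "'a pair_pre_digraph \<Rightarrow> 'a pair_pre_digraph \<Rightarrow> bool" where
  "undirected_spanning_tree T G \<longleftrightarrow>
     undirected_tree T \<and> spanning (with_proj T) (with_proj G)"

text \<open>
  Intended for spanning trees \<open>S\<close>, \<open>T\<close> of \<open>G\<close>; then the path \<open>p\<close> from \<open>u\<close> to \<open>v\<close> in \<open>S\<close> and
  the path \<open>q\<close> from \<open>u\<close> to \<open>v\<close> in \<open>T\<close> exist and are unique. The arc sets being symmetric, they
  are disjoint iff the trees have no edge in common.
\<close>

definition completely_independent ::
    "'a pair_pre_digraph \<Rightarrow> 'a pair_pre_digraph \<Rightarrow> 'a pair_pre_digraph \<Rightarrow> bool" where
  "completely_independent G S T \<longleftrightarrow>
     parcs S \<inter> parcs T = {} \<and>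
     (\<forall>u \<in> pverts G. \<forall>v \<in> pverts G. \<forall>p q.
        pre_digraph.apath (with_proj S) u p v \<longrightarrow>
        pre_digraph.apath (with_proj T) u q v \<longrightarrow>
        set (pre_digraph.awalk_verts (with_proj S) u p) \<inter>
        set (pre_digraph.awalk_verts (with_proj T) u q) \<subseteq> {u, v})"

lemma pair_graph_hypercube: "pair_graph (hypercube n)"
proof
  show fin: "finite (pverts (hypercube n))"
    using finite_lists_length_eq[of "UNIV :: bool set" n] by (simp add: hypercube_def)
  have mem: "length (fst e) = n \<and> length (snd e) = n \<and>
      card {i. i < n \<and> fst e ! i \<noteq> snd e ! i} = 1" if "e \<in> parcs (hypercube n)" for e
    using that unfolding hypercube_def pair_pre_digraph.select_convs mem_Collect_eq case_prod_unfold .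
  show fst: "fst e \<in> pverts (hypercube n)" and snd: "snd e \<in> pverts (hypercube n)"
    if "e \<in> parcs (hypercube n)" for e
    using mem[OF that] unfolding hypercube_def pair_pre_digraph.select_convs mem_Collect_eq
    by blast+
  show "fst e \<noteq> snd e" if "e \<in> parcs (hypercube n)" for e
  proof
    assume "fst e = snd e"
    then have "{i. i < n \<and> fst e ! i \<noteq> snd e ! i} = {}"
      by simp
    then show False
      using mem[OF that] by (metis card.empty zero_neq_one)
  qed
  have "parcs (hypercube n) \<subseteq> pverts (hypercube n) \<times> pverts (hypercube n)"
    using fst snd by (metis mem_Times_iff subsetI)
  then show "finite (parcs (hypercube n))"
    using fin by (meson finite_SigmaI finite_subset)
  show "symmetric (with_proj (hypercube n))"
    unfolding symmetric_def with_proj_simps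
  proof (rule symI)
    fix x y :: "bool list"
    have "{i. i < n \<and> x ! i \<noteq> y ! i} = {i. i < n \<and> y ! i \<noteq> x ! i}"
      by (rule Collect_cong) (rule conj_cong[OF refl], rule neq_commute)
    moreover assume "(x, y) \<in> parcs (hypercube n)"
    ultimately show "(y, x) \<in> parcs (hypercube n)"
      unfolding hypercube_def pair_pre_digraph.select_convs mem_Collect_eq case_prod_conv by metis
  qed
qed

end

(*
  Suppose that the vertices are coloured so that every colour class is connected, and that the
  edges are owned by at most one endpoint each so that every vertex owns an edge to every colour
  but its own. A spanning tree of a class, together with one owned edge into it for every vertex
  outside, is a spanning tree all of whose inner vertices lie in the class; the trees arising in
  this way from the different classes are completely independent.

  For such a colouring of the hypercube, give the coordinates labels in {0..<2^k} so that every
  label occurs twice in each of two blocks of 2 * 2^k coordinates. One further bit selects the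
  active block, and the colour is the xor of the labels of the 1-bits of the active block. The
  inactive block being free, any vertex of a class can be joined to any vertex of the same class
  with the other active block: copy the target's part of the inactive block, switch, and copy the
  rest. Flipping a coordinate of the active block with label d changes the colour by xor with d.
  Of the two coordinates with label d in a block, the even vertices own the edges along one and
  the odd vertices those along the other.
*)

theory Submission
  imports Defs
begin

section \<open>Trees given by a parent function\<close>

definition parent_tree :: "'a set \<Rightarrow> 'a \<Rightarrow> ('a \<Rightarrow> 'a) \<Rightarrow> 'a pair_pre_digraph" where
  "parent_tree V r f =
     \<lparr> pverts = V, parcs = {(x, y). (x \<in> V - {r} \<and> y = f x) \<or> (y \<in> V - {r} \<and> x = f y)} \<rparr>"

lemma pverts_parent_tree [simp]: "pverts (parent_tree V r f) = V"
  by (simp add: parent_tree_def)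

lemma parcs_parent_tree_iff:
  "(x, y) \<in> parcs (parent_tree V r f) \<longleftrightarrow>
     (x \<in> V - {r} \<and> y = f x) \<or> (y \<in> V - {r} \<and> x = f y)"
  by (simp add: parent_tree_def)

section \<open>Walks read as indexed lists of arcs\<close>

lemma cas_fst_nth:
  assumes "pre_digraph.cas (with_proj G) u p v" "i < length p"
  shows "fst (p ! i) = (if i = 0 then u else snd (p ! (i - 1)))"
  using assms
proof (induction p arbitrary: u i)
  case (Cons e p)
  then show ?case
    by (cases i) (auto simp: pre_digraph.cas.simps)
qed simp

lemma cas_snd_last:
  assumes "pre_digraph.cas (with_proj G) u p v" "p \<noteq> []"
  shows "snd (last p) = v"
  using assms
proof (induction p arbitrary: u)
  case (Cons e p)
  then show ?case
    by (cases p) (auto simp: pre_digraph.cas.simps)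
qed simp

text \<open>The height \<open>h\<close> is a termination measure: it forces iteration of
  \<open>f\<close> to end at \<open>r\<close>, and it excludes long cycles.\<close>

context
  fixes V :: "'a set" and r :: 'a and f :: "'a \<Rightarrow> 'a" and h :: "'a \<Rightarrow> nat"
  assumes finite_V: "finite V" and root_in: "r \<in> V"
    and parent_in: "\<And>v. v \<in> V - {r} \<Longrightarrow> f v \<in> V"
    and parent_less: "\<And>v. v \<in> V - {r} \<Longrightarrow> h (f v) < h v"
begin

lemma pair_graph_parent_tree: "pair_graph (parent_tree V r f)"
proof
  have sub: "parcs (parent_tree V r f) \<subseteq> V \<times> V"
    using parent_in by (auto simp: parcs_parent_tree_iff)
  show "finite (parcs (parent_tree V r f))"
    using sub finite_V by (meson finite_SigmaI finite_subset)
  show "fst e \<in> pverts (parent_tree V r f)" "snd e \<in> pverts (parent_tree V r f)"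
    if "e \<in> parcs (parent_tree V r f)" for e
    using that sub by auto
  show "fst e \<noteq> snd e" if "e \<in> parcs (parent_tree V r f)" for e
    using that parent_less by (cases e) (fastforce simp: parcs_parent_tree_iff)
  show "symmetric (with_proj (parent_tree V r f))"
    by (auto simp: symmetric_def sym_def parcs_parent_tree_iff)
qed (use finite_V in simp)

lemma connected_parent_tree: "connected (with_proj (parent_tree V r f))"
proof -
  interpret T: pair_graph "parent_tree V r f"
    by (rule pair_graph_parent_tree)
  have to_root: "v \<rightarrow>\<^sup>*\<^bsub>with_proj (parent_tree V r f)\<^esub> r" if "v \<in> V" for v
    using that
  proof (induction "h v" arbitrary: v rule: less_induct)
    case less
    show ?case
    proof (cases "v = r")
      case False
      with less.prems have v: "v \<in> V - {r}" by simp
      have "(v, f v) \<in> parcs (parent_tree V r f)"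
        using v by (simp add: parcs_parent_tree_iff)
      moreover have "f v \<rightarrow>\<^sup>*\<^bsub>with_proj (parent_tree V r f)\<^esub> r"
        using less.hyps parent_less parent_in v by blast
      ultimately show ?thesis
        using T.adj_reachable_trans by simp
    qed (simp add: T.reachable_refl root_in)
  qed
  \<comment> \<open>Climb from \<open>u\<close> to the root and descend to \<open>v\<close>;
    connectedness is defined through the symmetric closure.\<close>
  have "u \<rightarrow>\<^sup>*\<^bsub>with_proj (mk_symmetric (with_proj (parent_tree V r f)))\<^esub> v"
    if "u \<in> V" "v \<in> V" for u v
    by (rule T.reachable_mk_symmetricI
        [OF T.reachable_trans[OF to_root[OF that(1)] T.symmetric_reachable'[OF to_root[OF that(2)]]]])
  then show ?thesis
    using root_in by (auto simp: connected_def strongly_connected_def mk_symmetric_def)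
qed

text \<open>The neighbours, on a cycle, of a vertex of maximal height would both be its parent.\<close>

lemma no_long_cycle_parent_tree:
  "\<not> (\<exists>p. pre_digraph.cycle (with_proj (parent_tree V r f)) p \<and> 3 \<le> length p)"
proof
  let ?T = "parent_tree V r f"
  assume "\<exists>p. pre_digraph.cycle (with_proj ?T) p \<and> 3 \<le> length p"
  then obtain u p where aw: "pre_digraph.awalk (with_proj ?T) u p u"
    and dist: "distinct (tl (pre_digraph.awalk_verts (with_proj ?T) u p))"
    and len: "3 \<le> length p"
    by (auto simp: pre_digraph.cycle_def)
  let ?L = "length p"
  from aw have arcs: "set p \<subseteq> parcs ?T" and cas: "pre_digraph.cas (with_proj ?T) u p u"
    by (auto simp: pre_digraph.awalk_def)
  have "tl (pre_digraph.awalk_verts (with_proj ?T) u p) = map snd p"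
    using len pre_digraph.awalk_verts_conv'[OF cas] by auto
  with dist have dist': "distinct (map snd p)" by simp
  have pred: "fst (p ! i) = snd (p ! (if i = 0 then ?L - 1 else i - 1))" if "i < ?L" for i
  proof -
    have "p \<noteq> []" using len by auto
    then show ?thesis
      using cas_fst_nth[OF cas that] cas_snd_last[OF cas] by (simp add: last_conv_nth)
  qed
  obtain i where i: "i < ?L" and max: "\<And>j. j < ?L \<Longrightarrow> h (snd (p ! j)) \<le> h (snd (p ! i))"
  proof -
    let ?H = "(\<lambda>j. h (snd (p ! j))) ` {..<?L}"
    have ne: "?H \<noteq> {}" using len by (auto simp: lessThan_empty_iff)
    have "Max ?H \<in> ?H" using ne by (intro Max_in) auto
    then obtain i where "i < ?L" "h (snd (p ! i)) = Max ?H" by auto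
    then show thesis using that by (metis Max_ge finite_imageI finite_lessThan imageI lessThan_iff)
  qed
  have parent: "y = f x" if "(x, y) \<in> parcs ?T \<or> (y, x) \<in> parcs ?T" "h y \<le> h x" for x y
    using that parent_less by (fastforce simp: parcs_parent_tree_iff)
  \<comment> \<open>Arcs \<open>?a\<close> and \<open>?b\<close> come just before and after arc
    \<open>i\<close>, cyclically. They are distinct because the length is at least 3; for
    \<open>u, v, u\<close> they would coincide.\<close>
  let ?a = "if i = 0 then ?L - 1 else i - 1" and ?b = "if Suc i = ?L then 0 else Suc i"
  have ab: "?a < ?L" "?b < ?L" "?a \<noteq> ?b" using i len by auto
  have "(snd (p ! ?a), snd (p ! i)) \<in> parcs ?T"
    using pred[OF i] arcs i by (metis nth_mem prod.collapse subsetD)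
  then have "snd (p ! ?a) = f (snd (p ! i))"
    using parent max ab by blast
  moreover have "fst (p ! ?b) = snd (p ! i)"
  proof (cases "Suc i = ?L")
    case True
    then have "?L - 1 = i" by simp
    then show ?thesis using True pred[OF ab(2)] by simp
  qed (use pred[OF ab(2)] in simp)
  then have "(snd (p ! i), snd (p ! ?b)) \<in> parcs ?T"
    using arcs ab(2) by (metis nth_mem prod.collapse subsetD)
  then have "snd (p ! ?b) = f (snd (p ! i))"
    using parent max ab by blast
  ultimately have "map snd p ! ?a = map snd p ! ?b"
    using ab by simp
  then show False
    using nth_eq_iff_index_eq[OF dist', of ?a ?b] ab by simp
qed

lemma undirected_tree_parent_tree: "undirected_tree (parent_tree V r f)"
  using pair_graph_parent_tree connected_parent_tree no_long_cycle_parent_tree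
  by (simp add: undirected_tree_def)

end

section \<open>Inner vertices of paths, and shortest-path parents\<close>

lemma (in pair_wf_digraph) apath_inner_vertex:
  assumes "apath u p v" "w \<in> set (awalk_verts u p)" "w \<noteq> u" "w \<noteq> v"
  obtains x y where "x \<noteq> y" "(x, w) \<in> parcs G" "(w, y) \<in> parcs G"
proof -
  have "awalk u p v" using assms(1) by (simp add: apath_def)
  \<comment> \<open>Cut the path at \<open>w\<close>: the last arc before the cut and the first arc
    after it supply the two neighbours, distinct since a path repeats no vertex.\<close>
  then obtain q s where p: "p = q @ s" and q: "awalk u q w" and s: "awalk w s v"
    using awalk_decomp assms(2) by blast
  obtain q' e where q': "q = q' @ [e]"
    using q assms(3) by (cases q rule: rev_cases) (auto simp: awalk_Nil_iff)
  obtain e' s' where s': "s = e' # s'"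
    using s assms(4) by (cases s) (auto simp: awalk_Nil_iff)
  have e: "e \<in> parcs G" "snd e = w"
    using q q' by (auto simp: awalk_simps)
  have e': "e' \<in> parcs G" "fst e' = w"
    using s s' by (auto simp: awalk_simps)
  have "set (awalk_verts u q) \<inter> set (tl (awalk_verts w s)) = {}"
    using assms(1) q unfolding p apath_append_iff by auto
  moreover have "fst e \<in> set (awalk_verts u q)"
    using awalk_verts_arc1[of e q u] q' by simp
  moreover have "snd e' \<in> set (tl (awalk_verts w s))"
    using s by (cases s') (auto simp: s' awalk_simps)
  ultimately have "fst e \<noteq> snd e'" by (metis disjoint_iff)
  moreover have "(fst e, w) \<in> parcs G" "(w, snd e') \<in> parcs G"
    using e e' by (metis prod.collapse)+
  ultimately show thesis by (rule that)
qed

text \<open>Take \<open>h\<close> to be the distance to \<open>r\<close> along \<open>R\<close>; the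
  second vertex of a shortest walk serves as parent.\<close>

lemma parent_function_exists:
  assumes "\<And>v. v \<in> V \<Longrightarrow> (v, r) \<in> R\<^sup>*"
  shows "\<exists>f. \<exists>h :: 'a \<Rightarrow> nat. \<forall>v \<in> V - {r}. (v, f v) \<in> R \<and> h (f v) < h v"
proof -
  define h where "h v = (LEAST m. (v, r) \<in> R ^^ m)" for v
  have "\<exists>w. (v, w) \<in> R \<and> h w < h v" if v: "v \<in> V - {r}" for v
  proof -
    have "\<exists>m. (v, r) \<in> R ^^ m"
      using assms v by (auto simp: rtrancl_power)
    then have path: "(v, r) \<in> R ^^ h v"
      unfolding h_def by (rule LeastI_ex)
    then obtain m where m: "h v = Suc m"
      using v by (cases "h v") auto
    then obtain w where w: "(v, w) \<in> R" "(w, r) \<in> R ^^ m"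
      using path by (metis relpow_Suc_E2)
    have "h w \<le> m" unfolding h_def using w(2) by (rule Least_le)
    then show ?thesis using w m by auto
  qed
  then show ?thesis by metis
qed

section \<open>Completely independent spanning trees from a vertex colouring\<close>

theorem completely_independent_spanning_trees_of_colouring:
  fixes G :: "'a pair_pre_digraph" and colour :: "'a \<Rightarrow> 'c"
  assumes "pair_graph G"
    and nonempty: "\<And>i. i \<in> I \<Longrightarrow> \<exists>v \<in> pverts G. colour v = i"
    and connected: "\<And>i u v. i \<in> I \<Longrightarrow> u \<in> pverts G \<Longrightarrow> v \<in> pverts G \<Longrightarrow>
       colour u = i \<Longrightarrow> colour v = i \<Longrightarrow>
       (u, v) \<in> {(x, y). (x, y) \<in> parcs G \<and> colour x = i \<and> colour y = i}\<^sup>*"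
    and asym: "\<And>u v. owns u v \<Longrightarrow> \<not> owns v u"
    and dominating: "\<And>i v. i \<in> I \<Longrightarrow> v \<in> pverts G \<Longrightarrow> colour v \<noteq> i \<Longrightarrow>
       \<exists>w. (v, w) \<in> parcs G \<and> colour w = i \<and> owns v w"
  shows "\<exists>\<T>. card \<T> = card I \<and> (\<forall>T \<in> \<T>. undirected_spanning_tree T G) \<and>
           pairwise (completely_independent G) \<T>"
proof -
  interpret G: pair_graph G by fact
  \<comment> \<open>Admissible arcs from child to parent in tree \<open>i\<close>. All of them end
    in class \<open>i\<close>, so every parent has colour \<open>i\<close>.\<close>
  define arcs_to where
    "arcs_to i = {(v, w). (v, w) \<in> parcs G \<and> colour w = i \<and> (colour v = i \<or> owns v w)}" for i
  have "\<exists>r f. \<exists>h :: 'a \<Rightarrow> nat. r \<in> pverts G \<and> colour r = i \<and>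
      (\<forall>v \<in> pverts G - {r}. (v, f v) \<in> arcs_to i \<and> h (f v) < h v)" if i: "i \<in> I" for i
  proof -
    obtain r where r: "r \<in> pverts G" "colour r = i"
      using nonempty i by blast
    have inside: "(v, r) \<in> (arcs_to i)\<^sup>*" if "v \<in> pverts G" "colour v = i" for v
      using connected[OF i that(1) r(1) that(2) r(2)]
      by (rule rtrancl_mono[THEN subsetD, rotated]) (auto simp: arcs_to_def)
    have "(v, r) \<in> (arcs_to i)\<^sup>*" if v: "v \<in> pverts G" for v
    proof (cases "colour v = i")
      case False
      then obtain w where w: "(v, w) \<in> parcs G" "colour w = i" "owns v w"
        using dominating i v by blast
      then have "(v, w) \<in> arcs_to i" by (simp add: arcs_to_def)
      moreover have "(w, r) \<in> (arcs_to i)\<^sup>*"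
        using inside w G.in_arcsD2 by blast
      ultimately show ?thesis by (rule converse_rtrancl_into_rtrancl)
    qed (use inside v in blast)
    then have "\<exists>f. \<exists>h :: 'a \<Rightarrow> nat. \<forall>v \<in> pverts G - {r}. (v, f v) \<in> arcs_to i \<and> h (f v) < h v"
      by (rule parent_function_exists)
    then show ?thesis using r by blast
  qed
  then obtain r f and h :: "'c \<Rightarrow> 'a \<Rightarrow> nat" where
    root: "\<And>i. i \<in> I \<Longrightarrow> r i \<in> pverts G \<and> colour (r i) = i" and
    parent: "\<And>i v. i \<in> I \<Longrightarrow> v \<in> pverts G - {r i} \<Longrightarrow>
       (v, f i v) \<in> arcs_to i \<and> h i (f i v) < h i v"
    by metis
  define T where "T i = parent_tree (pverts G) (r i) (f i)" for i
  have parent_arc: "(v, f i v) \<in> parcs G" "colour (f i v) = i" "colour v = i \<or> owns v (f i v)"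
    if "i \<in> I" "v \<in> pverts G - {r i}" for i v
    using parent[OF that] by (auto simp: arcs_to_def)
  have tree: "undirected_tree (T i)" if i: "i \<in> I" for i
    unfolding T_def
    by (rule undirected_tree_parent_tree[where h = "h i"])
      (use root[OF i] parent[OF i] parent_arc[OF i] G.in_arcsD2 G.pair_finite_verts in blast)+
  have spanning: "spanning (with_proj (T i)) (with_proj G)" if i: "i \<in> I" for i
  proof -
    interpret T: pair_graph "T i" using tree[OF i] by (simp add: undirected_tree_def)
    have "parcs (T i) \<subseteq> parcs G"
      using parent_arc(1)[OF i] G.arcs_symmetric by (auto simp: T_def parcs_parent_tree_iff)
    then show ?thesis
      using G.wf_digraph T.wf_digraph
      by (auto simp: spanning_def subgraph_def compatible_def T_def)
  qed
  \<comment> \<open>Outside class \<open>i\<close> a vertex is nobody's parent, so its own parent is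
    its only neighbour.\<close>
  have leaf: "y = f i x" if "i \<in> I" "(x, y) \<in> parcs (T i)" "colour x \<noteq> i" for i x y
    using that parent_arc(2) by (auto simp: T_def parcs_parent_tree_iff)
  have disjoint: "parcs (T i) \<inter> parcs (T j) = {}" if ij: "i \<in> I" "j \<in> I" "i \<noteq> j" for i j
  proof -
    have False if "(x, y) \<in> parcs (T i)" "(x, y) \<in> parcs (T j)" for x y
    proof -
      \<comment> \<open>Suppose an edge is shared. If its child end differs in the two trees, each
        end is the other's parent; the ends then have colours \<open>j\<close> and \<open>i\<close>,
        so each owns the edge. If the child end is the same, its parent has two colours.\<close>
      have crossed: False if "i \<in> I" "j \<in> I" "i \<noteq> j" "v \<in> pverts G - {r i}" "w \<in> pverts G - {r j}"
        "w = f i v" "v = f j w" for i j v w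
        using parent_arc[OF that(1,4)] parent_arc[OF that(2,5)] that(3,6,7) asym by metis
      have same: False if "v \<in> pverts G - {r i}" "v \<in> pverts G - {r j}" "f i v = f j v" for v
        using parent_arc(2)[OF ij(1) that(1)] parent_arc(2)[OF ij(2) that(2)] that(3) ij(3) by simp
      from that show False
        unfolding T_def parcs_parent_tree_iff
        using same[of x] same[of y] crossed[OF ij, of x y] crossed[OF ij, of y x] by metis
    qed
    then show ?thesis by auto
  qed
  have inner: "colour w = i"
    if i: "i \<in> I" and path: "pre_digraph.apath (with_proj (T i)) u p v"
      and w: "w \<in> set (pre_digraph.awalk_verts (with_proj (T i)) u p)" "w \<noteq> u" "w \<noteq> v"
    for i u p v w
  proof (rule ccontr)
    \<comment> \<open>An inner vertex of a path has two distinct neighbours, which a leaf cannot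
      have. Inner vertices of different trees thus have different colours.\<close>
    assume ne: "colour w \<noteq> i"
    interpret T: pair_graph "T i" using tree[OF i] by (simp add: undirected_tree_def)
    obtain x y where "x \<noteq> y" "(x, w) \<in> parcs (T i)" "(w, y) \<in> parcs (T i)"
      using T.apath_inner_vertex[of u p v w] path w by auto
    then show False
      using leaf[OF i _ ne] T.arcs_symmetric by metis
  qed
  have "completely_independent G (T i) (T j)" if ij: "i \<in> I" "j \<in> I" "i \<noteq> j" for i j
    unfolding completely_independent_def
    using disjoint[OF ij] inner[OF ij(1)] inner[OF ij(2)] ij(3) by blast
  then have "pairwise (completely_independent G) (T ` I)"
    by (auto simp: pairwise_def)
  moreover have "inj_on T I"
  proof (rule inj_onI, rule ccontr)
    fix i j assume ij: "i \<in> I" "j \<in> I" "T i = T j" "i \<noteq> j"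
    \<comment> \<open>The roots differ in colour, so \<open>T i\<close> has at least one edge;
      edge-disjointness then separates \<open>T i\<close> from \<open>T j\<close>.\<close>
    have "r j \<in> pverts G - {r i}" using root[OF ij(1)] root[OF ij(2)] ij(4) by auto
    then have "(r j, f i (r j)) \<in> parcs (T i)"
      by (simp add: T_def parcs_parent_tree_iff)
    then show False using disjoint[OF ij(1,2,4)] ij(3) by auto
  qed
  ultimately show ?thesis
    using tree spanning
    by (intro exI[of _ "T ` I"]) (auto simp: card_image undirected_spanning_tree_def)
qed

section \<open>A colouring of the hypercube\<close>

definition flip :: "bool list \<Rightarrow> nat \<Rightarrow> bool list" where
  "flip x i = x[i := \<not> x ! i]"

lemma length_flip [simp]: "length (flip x i) = length x"
  by (simp add: flip_def)

lemma nth_flip: "i < length x \<Longrightarrow> flip x i ! j = (if j = i then \<not> x ! i else x ! j)"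
  by (auto simp: flip_def nth_list_update)

lemma hypercube_flip: "length x = n \<Longrightarrow> i < n \<Longrightarrow> (x, flip x i) \<in> parcs (hypercube n)"
proof -
  assume "length x = n" "i < n"
  then have "{j. j < n \<and> x ! j \<noteq> flip x i ! j} = {i}"
    by (auto simp: nth_flip)
  then show ?thesis
    using \<open>length x = n\<close> by (simp add: hypercube_def)
qed

text \<open>Since \<noteq> on truth values is exclusive or, the fold is the parity that bipartitions
  the hypercube.\<close>

definition odd_weight :: "bool list \<Rightarrow> bool" where
  "odd_weight x = foldr (\<noteq>) x False"

lemma odd_weight_flip: "i < length x \<Longrightarrow> odd_weight (flip x i) \<longleftrightarrow> \<not> odd_weight x"
  unfolding odd_weight_def flip_def
proof (induction x arbitrary: i)
  case (Cons b x)
  then show ?case by (cases i) auto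
qed simp

text \<open>Coordinate \<open>j\<close> carries the label \<open>j mod 2 ^ k\<close>, so
  \<open>2 * 2 ^ k\<close> consecutive coordinates carry every label exactly twice.\<close>

definition label :: "nat \<Rightarrow> nat list \<Rightarrow> bool list \<Rightarrow> nat" where
  "label k js x = foldr (\<lambda>j. xor (if x ! j then j mod 2 ^ k else 0)) js 0"

lemma label_cong: "(\<And>j. j \<in> set js \<Longrightarrow> x ! j = y ! j) \<Longrightarrow> label k js x = label k js y"
  unfolding label_def by (induction js) auto

lemma label_flip:
  assumes "distinct js" "i \<in> set js" "i < length x"
  shows "label k js (flip x i) = xor (i mod 2 ^ k) (label k js x)"
  using assms(1,2)
proof (induction js)
  case (Cons j js)
  show ?case
  proof (cases "j = i")
    case True
    have "label k js (flip x i) = label k js x"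
      using Cons.prems True assms(3) by (intro label_cong) (auto simp: nth_flip)
    then show ?thesis
      using True assms(3) by (simp add: label_def nth_flip flip: xor.assoc)
  next
    case False
    then have "label k js (flip x i) = xor (i mod 2 ^ k) (label k js x)"
      using Cons by simp
    then show ?thesis
      using False assms(3) by (simp add: label_def nth_flip xor.left_commute)
  qed
qed simp

lemma xor_less_power: "(a :: nat) < 2 ^ k \<Longrightarrow> b < 2 ^ k \<Longrightarrow> xor a b < 2 ^ k"
  by (metis take_bit_nat_eq_self_iff take_bit_xor)

lemma label_less: "label k js x < 2 ^ k"
  unfolding label_def by (induction js) (auto intro!: xor_less_power)

lemma label_zero: "(\<And>j. j \<in> set js \<Longrightarrow> \<not> x ! j) \<Longrightarrow> label k js x = 0"
  unfolding label_def by (induction js) auto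

section \<open>Blocks, colours and edge ownership\<close>

definition block :: "nat \<Rightarrow> bool \<Rightarrow> nat list" where
  "block k b = (if b then [2 * 2 ^ k..<4 * 2 ^ k] else [0..<2 * 2 ^ k])"

text \<open>The selector bit sits at position \<open>4 * 2 ^ k\<close>, directly after the two
  blocks.\<close>

definition colour :: "nat \<Rightarrow> bool list \<Rightarrow> nat" where
  "colour k x = label k (block k (x ! (4 * 2 ^ k))) x"

text \<open>Two coordinates with equal label in one block have consecutive quotients
  \<open>i div 2 ^ k\<close>, so the parity of the quotient tells them apart.\<close>

definition owns :: "nat \<Rightarrow> bool list \<Rightarrow> bool list \<Rightarrow> bool" where
  "owns k x y \<longleftrightarrow> (\<exists>i < length x. y = flip x i \<and> (odd_weight x \<longleftrightarrow> odd (i div 2 ^ k)))"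

text \<open>Both ends flip the same coordinate, which demands one fixed weight parity, whereas
  adjacent vertices have opposite parities.\<close>

lemma owns_asym: "owns k x y \<Longrightarrow> \<not> owns k y x"
proof
  assume "owns k x y" "owns k y x"
  then obtain i j where i: "i < length x" "y = flip x i" "odd_weight x \<longleftrightarrow> odd (i div 2 ^ k)"
    and j: "j < length y" "x = flip y j" "odd_weight y \<longleftrightarrow> odd (j div 2 ^ k)"
    unfolding owns_def by blast
  have "i = j"
    using i j nth_flip by metis
  then show False using i j odd_weight_flip by metis
qed

lemma set_block_less: "j \<in> set (block k b) \<Longrightarrow> j < 4 * 2 ^ k"
  by (auto simp: block_def split: if_splits)

lemma colour_cong:
  assumes "x ! (4 * 2 ^ k) = y ! (4 * 2 ^ k)"
    and "\<And>j. j \<in> set (block k (y ! (4 * 2 ^ k))) \<Longrightarrow> x ! j = y ! j"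
  shows "colour k x = colour k y"
  using assms by (auto simp: colour_def intro: label_cong)

lemma colour_flip:
  assumes "4 * 2 ^ k < length x" "i \<in> set (block k (x ! (4 * 2 ^ k)))"
  shows "colour k (flip x i) = xor (i mod 2 ^ k) (colour k x)"
proof -
  have "i < 4 * 2 ^ k" using assms(2) by (rule set_block_less)
  moreover have "distinct (block k (x ! (4 * 2 ^ k)))" by (simp add: block_def)
  ultimately show ?thesis
    using assms by (simp add: colour_def nth_flip label_flip)
qed

lemma colour_dominating:
  assumes n: "4 * 2 ^ k < n" "length x = n" and c: "c < 2 ^ k"
  shows "\<exists>y. (x, y) \<in> parcs (hypercube n) \<and> colour k y = c \<and> owns k x y"
proof -
  let ?b = "x ! (4 * 2 ^ k)"
  \<comment> \<open>\<open>d\<close> is the label whose xor turns the present colour into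
    \<open>c\<close>.\<close>
  define d where "d = xor c (colour k x)"
  have d: "d < 2 ^ k"
    unfolding d_def colour_def using c label_less by (rule xor_less_power)
  \<comment> \<open>The quotient \<open>q\<close> selects the active block (0, 1 or 2, 3) and,
    within it, the copy of label \<open>d\<close> along which \<open>x\<close> owns its
    edge.\<close>
  define q :: nat where "q = (if ?b then 2 else 0) + (if odd_weight x then 1 else 0)"
  define i where "i = q * 2 ^ k + d"
  have "i div 2 ^ k = q" "i mod 2 ^ k = d" using d by (auto simp: i_def)
  moreover have "i \<in> set (block k ?b)"
    using d by (auto simp: block_def i_def q_def)
  moreover have "odd q \<longleftrightarrow> odd_weight x" by (auto simp: q_def)
  moreover have "xor d (colour k x) = c" by (simp add: d_def xor.assoc)
  moreover have "i < n" using set_block_less calculation(3) n(1) by fastforce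
  ultimately show ?thesis
    using n hypercube_flip[of x n i] colour_flip[of k x i]
    by (intro exI[of _ "flip x i"]) (auto simp: owns_def)
qed

section \<open>Nonempty and connected colour classes\<close>

lemma colour_layer_exists:
  assumes n: "4 * 2 ^ k < n" and c: "c < 2 ^ k"
  shows "\<exists>x. length x = n \<and> x ! (4 * 2 ^ k) = b \<and> colour k x = c"
proof -
  define x where "x = (replicate n False)[4 * 2 ^ k := b]"
  have x: "length x = n" "x ! (4 * 2 ^ k) = b" using n by (auto simp: x_def)
  have "colour k x = 0"
    unfolding colour_def
  proof (rule label_zero)
    fix j assume "j \<in> set (block k (x ! (4 * 2 ^ k)))"
    then have "j < 4 * 2 ^ k" by (rule set_block_less)
    then show "\<not> x ! j" using n by (simp add: x_def)
  qed
  \<comment> \<open>The vector \<open>x\<close> has colour 0, so flipping a coordinate of label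
    \<open>c\<close> in its active block yields colour \<open>c\<close>.\<close>
  define i where "i = (if b then 2 else 0) * 2 ^ k + c"
  have "i mod 2 ^ k = c" using c by (auto simp: i_def)
  moreover have i: "i \<in> set (block k b)" using c by (auto simp: block_def i_def)
  ultimately have "colour k (flip x i) = c"
    using colour_flip[of k x i] x n \<open>colour k x = 0\<close> by simp
  moreover have "flip x i ! (4 * 2 ^ k) = b"
    using set_block_less[OF i] x n by (simp add: nth_flip)
  ultimately show ?thesis using x(1) by (intro exI[of _ "flip x i"]) simp
qed

text \<open>Overwriting \<open>x\<close> by \<open>y\<close> from left to right stays in the subcube
  spanned by both, where \<open>P\<close> holds throughout.\<close>

lemma hypercube_path_between:
  assumes "length x = n" "length y = n"
    and between: "\<And>z. length z = n \<Longrightarrow> (\<And>j. j < n \<Longrightarrow> z ! j = x ! j \<or> z ! j = y ! j) \<Longrightarrow> P z"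
  shows "(x, y) \<in> {(u, v). (u, v) \<in> parcs (hypercube n) \<and> P u \<and> P v}\<^sup>*" (is "_ \<in> ?E\<^sup>*")
proof -
  let ?z = "\<lambda>m. take m y @ drop m x"
  have P: "P (?z m)" if "m \<le> n" for m
    using that assms(1,2) by (intro between) (auto simp: nth_append)
  have "(x, ?z m) \<in> ?E\<^sup>*" if "m \<le> n" for m
    using that
  proof (induction m)
    case (Suc m)
    have "?z (Suc m) = (?z m)[m := y ! m]"
    proof (rule nth_equalityI)
      fix j assume "j < length (?z (Suc m))"
      then show "?z (Suc m) ! j = (?z m)[m := y ! m] ! j"
        using Suc.prems assms(1,2)
        by (cases j m rule: linorder_cases) (auto simp: nth_append nth_list_update)
    qed (use Suc.prems assms(1,2) in simp)
    then have "?z (Suc m) = ?z m \<or> ?z (Suc m) = flip (?z m) m"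
      by (cases "y ! m = ?z m ! m") (auto simp: flip_def)
    moreover have "(?z m, flip (?z m) m) \<in> parcs (hypercube n)"
      using Suc.prems assms(1,2) by (intro hypercube_flip) auto
    \<comment> \<open>Where the bits already agree the walk stays put.\<close>
    ultimately have "?z (Suc m) = ?z m \<or> (?z m, ?z (Suc m)) \<in> ?E"
      using P[of m] P[of "Suc m"] Suc.prems by auto
    then show ?case
      using Suc by (metis (no_types, lifting) Suc_leD rtrancl.rtrancl_into_rtrancl)
  qed simp
  from this[of n] show ?thesis using assms(1,2) by simp
qed

lemma colour_class_connected:
  assumes n: "4 * 2 ^ k < n" and x: "length x = n" "colour k x = c"
    and y: "length y = n" "colour k y = c"
  shows "(x, y) \<in> {(u, v). (u, v) \<in> parcs (hypercube n) \<and> colour k u = c \<and> colour k v = c}\<^sup>*"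
    (is "_ \<in> ?E\<^sup>*")
proof -
  let ?D = "4 * 2 ^ k :: nat"
  have opposite: "(u, v) \<in> ?E\<^sup>*"
    if u: "length u = n" "colour k u = c" and v: "length v = n" "colour k v = c"
      and uv: "u ! ?D \<noteq> v ! ?D" for u v
  proof -
    let ?A = "set (block k (u ! ?D))" and ?B = "set (block k (v ! ?D))"
    have AB: "?A \<inter> ?B = {}" using uv by (auto simp: block_def split: if_splits)
    \<comment> \<open>The route is \<open>u\<close>, \<open>s\<close>, \<open>t\<close>,
      \<open>v\<close>: \<open>s\<close> keeps the selector and active block of \<open>u\<close> and
      takes the rest from \<open>v\<close>; \<open>t\<close> changes the selector only.\<close>
    define s where "s = map (\<lambda>j. if j \<in> ?A \<union> {?D} then u ! j else v ! j) [0..<n]"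
    define t where "t = map (\<lambda>j. if j \<in> ?A then u ! j else v ! j) [0..<n]"
    have len: "length s = n" "length t = n" by (simp_all add: s_def t_def)
    have s: "s ! j = (if j \<in> ?A \<union> {?D} then u ! j else v ! j)" if "j < n" for j
      using that by (simp add: s_def)
    have t: "t ! j = (if j \<in> ?A then u ! j else v ! j)" if "j < n" for j
      using that by (simp add: t_def)
    have D: "?D \<notin> ?A" "?D \<notin> ?B" using set_block_less by blast+
    have less_n: "j < n" if "j \<in> ?A \<or> j \<in> ?B" for j
      using that set_block_less n by fastforce
    have like_u: "colour k z = c" if "z ! ?D = u ! ?D" "\<And>j. j \<in> ?A \<Longrightarrow> z ! j = u ! j" for z
      using colour_cong[of z k u] that u by simp
    have like_v: "colour k z = c" if "z ! ?D = v ! ?D" "\<And>j. j \<in> ?B \<Longrightarrow> z ! j = v ! j" for z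
      using colour_cong[of z k v] that v by simp
    have "(u, s) \<in> ?E\<^sup>*"
    proof (rule hypercube_path_between[OF u(1) len(1)])
      fix z assume "length z = n" and z: "\<And>j. j < n \<Longrightarrow> z ! j = u ! j \<or> z ! j = s ! j"
      show "colour k z = c"
      proof (rule like_u)
        show "z ! ?D = u ! ?D" using z[OF n] s[OF n] by auto
        show "z ! j = u ! j" if "j \<in> ?A" for j
          using z[of j] s[of j] that less_n by auto
      qed
    qed
    moreover have "(s, t) \<in> ?E\<^sup>*"
    proof (rule hypercube_path_between[OF len])
      fix z assume "length z = n" and z: "\<And>j. j < n \<Longrightarrow> z ! j = s ! j \<or> z ! j = t ! j"
      \<comment> \<open>Between \<open>s\<close> and \<open>t\<close> block \<open>?A\<close> is
        that of \<open>u\<close> and block \<open>?B\<close> that of \<open>v\<close>, so either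
        selector value gives colour \<open>c\<close>.\<close>
      have on_A: "z ! j = u ! j" if "j \<in> ?A" for j
        using z[of j] s[of j] t[of j] that less_n by auto
      have on_B: "z ! j = v ! j" if "j \<in> ?B" for j
      proof -
        have "j \<notin> ?A" "j \<noteq> ?D" using that AB D by auto
        then show ?thesis using z[of j] s[of j] t[of j] that less_n by auto
      qed
      show "colour k z = c"
      proof (cases "z ! ?D = u ! ?D")
        case True
        then show ?thesis using on_A by (rule like_u)
      next
        case False
        then have "z ! ?D = v ! ?D" using uv by blast
        then show ?thesis using on_B by (rule like_v)
      qed
    qed
    moreover have "(t, v) \<in> ?E\<^sup>*"
    proof (rule hypercube_path_between[OF len(2) v(1)])
      fix z assume "length z = n" and z: "\<And>j. j < n \<Longrightarrow> z ! j = t ! j \<or> z ! j = v ! j"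
      show "colour k z = c"
      proof (rule like_v)
        show "z ! ?D = v ! ?D" using z[OF n] unfolding t[OF n] by (simp only: D if_False simp_thms)
        show "z ! j = v ! j" if "j \<in> ?B" for j
        proof -
          have "j \<notin> ?A" using that AB by auto
          then show ?thesis using z[of j] t[of j] that less_n by auto
        qed
      qed
    qed
    ultimately show ?thesis by (meson rtrancl_trans)
  qed
  show ?thesis
  proof (cases "x ! ?D = y ! ?D")
    case True
    \<comment> \<open>With equal selectors, detour through a vertex \<open>z\<close> of the class
      with the opposite selector.\<close>
    have "c < 2 ^ k" using x(2) label_less by (metis colour_def)
    then obtain z where "length z = n" "z ! ?D = (\<not> x ! ?D)" "colour k z = c"
      using colour_layer_exists n by blast
    then show ?thesis
      using opposite[OF x, of z] opposite[OF _ _ y, of z] True by (meson rtrancl_trans)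
  qed (use opposite x y in blast)
qed

theorem theorem4:
  fixes k n :: nat
  assumes "k \<ge> 1" and "n \<ge> 16 * 2 ^ k - 1"
  shows "\<exists>\<T> :: bool list pair_pre_digraph set.
           card \<T> = 2 ^ k \<and>
           (\<forall>T \<in> \<T>. undirected_spanning_tree T (hypercube n)) \<and>
           pairwise (completely_independent (hypercube n)) \<T>"
proof -
  \<comment> \<open>Position \<open>4 * 2 ^ k\<close> of the selector must exist; this bound absorbs
    the \<open>- 1\<close> in the hypothesis on \<open>n\<close>.\<close>
  have "(1 :: nat) \<le> 2 ^ k" by simp
  then have n: "4 * 2 ^ k < n" using assms(2) by linarith
  have verts: "x \<in> pverts (hypercube n) \<longleftrightarrow> length x = n" for x
    by (simp add: hypercube_def)
  have "\<exists>\<T>. card \<T> = card {..<2 ^ k :: nat} \<and>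
      (\<forall>T \<in> \<T>. undirected_spanning_tree T (hypercube n)) \<and>
      pairwise (completely_independent (hypercube n)) \<T>"
  proof (rule completely_independent_spanning_trees_of_colouring
      [where colour = "colour k" and owns = "owns k"])
    show "pair_graph (hypercube n)" by (rule pair_graph_hypercube)
    show "\<exists>v \<in> pverts (hypercube n). colour k v = i" if "i \<in> {..<2 ^ k}" for i
      using colour_layer_exists[OF n] that verts by blast
  next
    fix i u v
    assume "u \<in> pverts (hypercube n)" "v \<in> pverts (hypercube n)" "colour k u = i" "colour k v = i"
    then show "(u, v) \<in> {(x, y). (x, y) \<in> parcs (hypercube n) \<and> colour k x = i \<and> colour k y = i}\<^sup>*"
      by (intro colour_class_connected[OF n]) (simp_all add: verts)
  next
    show "\<not> owns k v u" if "owns k u v" for u v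
      using that by (rule owns_asym)
    show "\<exists>w. (v, w) \<in> parcs (hypercube n) \<and> colour k w = i \<and> owns k v w"
      if "i \<in> {..<2 ^ k}" "v \<in> pverts (hypercube n)" for i v
      using colour_dominating[OF n] that verts by simp
  qed
  then show ?thesis by simp
qed

end
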